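(* Let $n\ge 2$, let $\mathcal{H}_1,\dots,\mathcal{H}_n$ be finite-dimensional complex Hilbert spaces, and let $\mathcal{S}$ be a complete orthogonal product basis of the multipartite Hilbert space $\mathcal{H}=\mathcal{H}_1\otimes\mathcal{H}_2\otimes\cdots\otimes\mathcal{H}_n$. If $\mathcal{S}$ is distinguishable by LOCC (among the $n$ parties), then $\mathcal{S}$ cannot be made locally indistinguishable via any (orthogonality-preserving) LPCC protocol. That is, $\mathcal{S}$ is not activable under LPCC.
   Context: A complete orthogonal product basis of $\mathcal{H}_1\otimes\cdots\otimes\mathcal{H}_n$ is an orthonormal basis of this space all of whose elements are fully product vectors $|\alpha_i\rangle_1\otimes|\beta_i\rangle_2\otimes\cdots\otimes|\gamma_i\rangle_n$. A finite set of pairwise orthogonal states shared between spatially separated parties (party $j$ holding the factor $\mathcal{H}_j$) is locally distinguishable (distinguishable by LOCC) if, when one state is secretly chosen from the known set, the parties can identify it perfectly using only local quantum operations (local measurements) and classical communication (LOCC); otherwise it is locally indistinguishable. A local projective measurement by party $j$ is a family $\{P_k\}$ of orthogonal projectors on $\mathcal{H}_j$ with $P_kP_l=0$ for $k\neq l$ and $\sum_k P_k=\mathbb{I}$; outcome $k$ sends a state $|\psi\rangle$ to the (unnormalized) post-measurement state obtained by applying $P_k$ on factor $j$ and the identity on the other factors. Such a measurement is orthogonality-preserving for a set of pairwise orthogonal states if, for every outcome $k$, the post-measurement states of the set are pairwise orthogonal. An (orthogonality-preserving) LPCC protocol (local projective measurements with classical communication) is a finite sequence of steps; at each step one party, chosen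 possibly depending on the previous outcomes, performs a local projective measurement (also possibly depending on previous outcomes) that is orthogonality-preserving for the current set of states, and the outcome is communicated to the other parties. The current set is then replaced by the set of nonzero post-measurement states for that outcome (normalized). A locally distinguishable set is activable under LPCC if there is an orthogonality-preserving LPCC protocol and a sequence of outcomes after which the set of remaining nonzero post-measurement states is locally indistinguishable (by LOCC). *)

theory Defs
  imports "Jordan_Normal_Form.Schur_Decomposition"
begin

text \<open>
  A list \<open>ds\<close> of natural numbers stands for the tensor product of the spaces
  \<open>\<complex>^(ds ! j)\<close>, party \<open>j\<close> (counted from 0) holding the \<open>j\<close>-th factor.  A vector of the
  tensor product is the family of its coordinates in the computational product basis,
  indexed by multi-indices and extended by 0 to all other lists.
\<close>

type_synonym state = "nat list \<Rightarrow> complex"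

definition multi_indices :: "nat list \<Rightarrow> nat list set" where
  "multi_indices ds = {ix. length ix = length ds \<and> (\<forall>j<length ds. ix ! j < ds ! j)}"

definition tensor_space :: "nat list \<Rightarrow> state set" where
  "tensor_space ds = {\<psi>. \<forall>ix. ix \<notin> multi_indices ds \<longrightarrow> \<psi> ix = 0}"

definition zero_state :: state where
  "zero_state = (\<lambda>ix. 0)"

definition inner_prod :: "nat list \<Rightarrow> state \<Rightarrow> state \<Rightarrow> complex" where
  "inner_prod ds \<phi> \<psi> = (\<Sum>ix\<in>multi_indices ds. cnj (\<phi> ix) * \<psi> ix)"

definition state_norm :: "nat list \<Rightarrow> state \<Rightarrow> real" where
  "state_norm ds \<psi> = sqrt (Re (inner_prod ds \<psi> \<psi>))"

definition normalize_state :: "nat list \<Rightarrow> state \<Rightarrow> state" where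
  "normalize_state ds \<psi> = (\<lambda>ix. \<psi> ix / complex_of_real (state_norm ds \<psi>))"

definition product_state :: "nat list \<Rightarrow> complex vec list \<Rightarrow> state" where
  "product_state ds vs =
     (\<lambda>ix. if ix \<in> multi_indices ds then \<Prod>j<length ds. vs ! j $ (ix ! j) else 0)"

definition is_product_state :: "nat list \<Rightarrow> state \<Rightarrow> bool" where
  "is_product_state ds \<psi> \<longleftrightarrow>
     (\<exists>vs. length vs = length ds \<and> (\<forall>j<length ds. vs ! j \<in> carrier_vec (ds ! j)) \<and>
           \<psi> = product_state ds vs)"

definition orthonormal_basis :: "nat list \<Rightarrow> state set \<Rightarrow> bool" where
  "orthonormal_basis ds S \<longleftrightarrow>
     finite S \<and> S \<subseteq> tensor_space ds \<and>
     (\<forall>\<phi>\<in>S. \<forall>\<psi>\<in>S. inner_prod ds \<phi> \<psi> = (if \<phi> = \<psi> then 1 else 0)) \<and>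
     (\<forall>\<psi>\<in>tensor_space ds. \<exists>c. \<psi> = (\<lambda>ix. \<Sum>\<phi>\<in>S. c \<phi> * \<phi> ix))"

definition complete_orthogonal_product_basis :: "nat list \<Rightarrow> state set \<Rightarrow> bool" where
  "complete_orthogonal_product_basis ds S \<longleftrightarrow>
     orthonormal_basis ds S \<and> (\<forall>\<psi>\<in>S. is_product_state ds \<psi>)"

text \<open>
  \<open>local_op ds j A\<close> applies \<open>A\<close> to factor \<open>j\<close> and the identity to the other factors.
  \<open>A\<close> need not be square: the result lives in \<open>tensor_space (ds[j := dim_row A])\<close>.
\<close>

definition local_op :: "nat list \<Rightarrow> nat \<Rightarrow> complex mat \<Rightarrow> state \<Rightarrow> state" where
  "local_op ds j A \<psi> =
     (\<lambda>ix. if ix \<in> multi_indices (ds[j := dim_row A])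
           then \<Sum>l<dim_col A. A $$ (ix ! j, l) * \<psi> (ix[j := l]) else 0)"

text \<open>
  Outcome \<open>k < m\<close> of an instrument is the completely positive map
  \<open>\<rho> \<mapsto> (\<Sum>A\<leftarrow>K k. A \<rho> A\<^sup>\<dagger>)\<close> into operators on \<open>\<complex>^(e k)\<close>; the condition on the
  entries says that the sum of all \<open>A\<^sup>\<dagger> A\<close> is the identity, i.e. that the total map
  preserves the trace.
  Output dimensions may differ from the input dimension, which covers the use of ancillas.
\<close>

definition local_instrument ::
  "nat \<Rightarrow> nat \<Rightarrow> (nat \<Rightarrow> nat) \<Rightarrow> (nat \<Rightarrow> complex mat list) \<Rightarrow> bool" where
  "local_instrument d m e K \<longleftrightarrow>
     (\<forall>k<m. \<forall>A\<in>set (K k). A \<in> carrier_mat (e k) d) \<and>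
     mat d d (\<lambda>(a, b). \<Sum>k<m. \<Sum>A\<leftarrow>K k. (mat_adjoint A * A) $$ (a, b)) = 1\<^sub>m d"

text \<open>
  A finite LOCC protocol is a tree: in \<open>Operate j m e K next\<close> party \<open>j\<close> applies an
  instrument with \<open>m\<close> outcomes and broadcasts the outcome \<open>k\<close>, whereupon the parties
  continue with \<open>next k\<close>; in \<open>Guess s\<close> they announce \<open>s\<close>.
\<close>

datatype 'a locc =
    Guess 'a
  | Operate nat nat "nat \<Rightarrow> nat" "nat \<Rightarrow> complex mat list" "nat \<Rightarrow> 'a locc"

primrec valid_locc :: "'a locc \<Rightarrow> nat list \<Rightarrow> bool" where
  "valid_locc (Guess s) ds \<longleftrightarrow> True"
| "valid_locc (Operate j m e K next) ds \<longleftrightarrow>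
     j < length ds \<and> local_instrument (ds ! j) m e K \<and>
     (\<forall>k<m. valid_locc (next k) (ds[j := e k]))"

text \<open>
  \<open>guess_prob p ds s \<phi>\<close> is the probability that \<open>p\<close> ends with the guess \<open>s\<close> when run on
  \<open>\<phi>\<close>.  Intermediate vectors are kept unnormalized, so that squared norms are joint
  probabilities; the sum over \<open>A\<close> accounts for the mixed state left by outcome \<open>k\<close>.
\<close>

primrec guess_prob :: "'a locc \<Rightarrow> nat list \<Rightarrow> 'a \<Rightarrow> state \<Rightarrow> real" where
  "guess_prob (Guess t) ds s \<phi> = (if t = s then (state_norm ds \<phi>)\<^sup>2 else 0)"
| "guess_prob (Operate j m e K next) ds s \<phi> =
     (\<Sum>k<m. \<Sum>A\<leftarrow>K k. guess_prob (next k) (ds[j := e k]) s (local_op ds j A \<phi>))"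

definition locally_distinguishable :: "nat list \<Rightarrow> state set \<Rightarrow> bool" where
  "locally_distinguishable ds S \<longleftrightarrow>
     (\<exists>p :: state locc. valid_locc p ds \<and> (\<forall>\<psi>\<in>S. guess_prob p ds \<psi> \<psi> = 1))"

definition projective_measurement :: "nat \<Rightarrow> nat \<Rightarrow> (nat \<Rightarrow> complex mat) \<Rightarrow> bool" where
  "projective_measurement d m P \<longleftrightarrow>
     (\<forall>k<m. P k \<in> carrier_mat d d \<and> mat_adjoint (P k) = P k \<and> P k * P k = P k) \<and>
     (\<forall>k<m. \<forall>l<m. k \<noteq> l \<longrightarrow> P k * P l = 0\<^sub>m d d) \<and>
     mat d d (\<lambda>(a, b). \<Sum>k<m. P k $$ (a, b)) = 1\<^sub>m d"

text \<open>
  Orthogonality is required for the post-measurement vectors of any two distinct states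
  of the set, even if these vectors happen to coincide.
\<close>

definition orthogonality_preserving ::
  "nat list \<Rightarrow> nat \<Rightarrow> nat \<Rightarrow> (nat \<Rightarrow> complex mat) \<Rightarrow> state set \<Rightarrow> bool" where
  "orthogonality_preserving ds j m P S \<longleftrightarrow>
     (\<forall>k<m. \<forall>\<phi>\<in>S. \<forall>\<psi>\<in>S. \<phi> \<noteq> \<psi> \<longrightarrow>
        inner_prod ds (local_op ds j (P k) \<phi>) (local_op ds j (P k) \<psi>) = 0)"

definition post_states :: "nat list \<Rightarrow> nat \<Rightarrow> complex mat \<Rightarrow> state set \<Rightarrow> state set" where
  "post_states ds j Q S =
     {normalize_state ds (local_op ds j Q \<psi>) | \<psi>. \<psi> \<in> S \<and> local_op ds j Q \<psi> \<noteq> zero_state}"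

datatype lpcc =
    Stop
  | Measure nat nat "nat \<Rightarrow> complex mat" "nat \<Rightarrow> lpcc"

primrec orthogonality_preserving_lpcc :: "lpcc \<Rightarrow> nat list \<Rightarrow> state set \<Rightarrow> bool" where
  "orthogonality_preserving_lpcc Stop ds S \<longleftrightarrow> True"
| "orthogonality_preserving_lpcc (Measure j m P next) ds S \<longleftrightarrow>
     j < length ds \<and> projective_measurement (ds ! j) m P \<and>
     orthogonality_preserving ds j m P S \<and>
     (\<forall>k<m. orthogonality_preserving_lpcc (next k) ds (post_states ds j (P k) S))"

text \<open>The sets of remaining states, one for each possible sequence of outcomes.\<close>

primrec final_sets :: "lpcc \<Rightarrow> nat list \<Rightarrow> state set \<Rightarrow> state set set" where
  "final_sets Stop ds S = {S}"
| "final_sets (Measure j m P next) ds S =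
     (\<Union>k<m. final_sets (next k) ds (post_states ds j (P k) S))"

definition activable_under_lpcc :: "nat list \<Rightarrow> state set \<Rightarrow> bool" where
  "activable_under_lpcc ds S \<longleftrightarrow>
     (\<exists>p. orthogonality_preserving_lpcc p ds S \<and>
          (\<exists>T\<in>final_sets p ds S. \<not> locally_distinguishable ds T))"

end

(*
  After an orthogonality-preserving LPCC protocol the remaining states are the normalized nonzero
  vectors among A psi, psi in S, where A is the tensor product of local operators A_1, ..., A_n and
  the A psi are pairwise orthogonal.  Orthogonality says that A^* A has no off-diagonal entries in
  the complete basis S, so every psi with A psi nonzero is an eigenvector of A^* A; as psi is a
  product vector, each of its factors is an eigenvector of A_j^* A_j.  Hence A_j preserves the inner
  products of the normalized factors, and a single local isometry maps A_j u / |A_j u| back to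
  u / |u| for all factors u at once.  So the parties can restore the original states, up to a
  relabelling, and then distinguish them by the given protocol.
*)

theory Submission
  imports Defs
begin

subsection \<open>Partial isometries with prescribed values\<close>

text \<open>The statement cannot be iterated measurement by measurement: after one step the
  remaining states usually span a proper subspace, so they no longer form a complete basis.
  Therefore only the accumulated local operators \<open>A\<close> change along a protocol, and each
  set of remaining states is compared directly with the original \<open>S\<close>. The passage from
  psi to its factors rests on A^* A psi being again a product vector, with factors A_j^* A_j u_j:
  two proportional nonzero product vectors have proportional factors. The isometry exists because
  vectors with equal Gram matrices are related by a linear isometry of their spans. Only this
  partial isometry W is constructed. To make it a physical operation, the projector 1 - W^* W is
  added as a second Kraus operator; it annihilates every vector that W is meant to restore.\<close>

lemma cscalar_prod_sum: "u \<bullet>c (v :: complex vec) = (\<Sum>l<dim_vec v. cnj (v $ l) * u $ l)"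
  by (simp add: scalar_prod_def lessThan_atLeast0 mult.commute)

lemma mat_adjoint_carrier [simp]:
  "A \<in> carrier_mat m n \<Longrightarrow> mat_adjoint A \<in> carrier_mat n m"
  by (auto simp: mat_adjoint_def)

lemma dim_mat_adjoint [simp]:
  "dim_row (mat_adjoint A) = dim_col A" "dim_col (mat_adjoint A) = dim_row A"
  by (auto simp: mat_adjoint_def)

lemma index_mat_adjoint:
  assumes "A \<in> carrier_mat m n" "i < n" "j < m"
  shows "mat_adjoint A $$ (i, j) = conjugate (A $$ (j, i))"
  using assms by (auto simp: mat_adjoint_def mat_of_rows_def)

lemma mat_adjoint_adjoint [simp]:
  fixes A :: "complex mat" shows "mat_adjoint (mat_adjoint A) = A"
proof (rule eq_matI)
  have A: "A \<in> carrier_mat (dim_row A) (dim_col A)" by simp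
  note A' = mat_adjoint_carrier[OF A]
  show "dim_row (mat_adjoint (mat_adjoint A)) = dim_row A"
    "dim_col (mat_adjoint (mat_adjoint A)) = dim_col A"
    by simp_all
  fix i j assume "i < dim_row A" "j < dim_col A"
  then show "mat_adjoint (mat_adjoint A) $$ (i, j) = A $$ (i, j)"
    by (simp add: index_mat_adjoint[OF A] index_mat_adjoint[OF A'])
qed

lemma mat_adjoint_mult:
  fixes A B :: "complex mat"
  assumes A: "A \<in> carrier_mat m k" and B: "B \<in> carrier_mat k n"
  shows "mat_adjoint (A * B) = mat_adjoint B * mat_adjoint A"
proof (rule eq_matI)
  have AB: "A * B \<in> carrier_mat m n" using A B by simp
  fix i j assume "i < dim_row (mat_adjoint B * mat_adjoint A)" "j < dim_col (mat_adjoint B * mat_adjoint A)"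
  then have "i < n" "j < m" using A B by auto
  then show "mat_adjoint (A * B) $$ (i, j) = (mat_adjoint B * mat_adjoint A) $$ (i, j)"
    using A B by (simp add: index_mat_adjoint[OF AB] scalar_prod_def row_def col_def
        index_mat_adjoint[OF A] index_mat_adjoint[OF B] mult.commute)
qed (use A B in auto)

lemma mat_adjoint_minus:
  fixes A B :: "complex mat"
  assumes A: "A \<in> carrier_mat m n" and B: "B \<in> carrier_mat m n"
  shows "mat_adjoint (A - B) = mat_adjoint A - mat_adjoint B"
proof -
  have "A - B \<in> carrier_mat m n" using A B by (intro minus_carrier_mat)
  from index_mat_adjoint[OF this] show ?thesis
    using A B by (intro eq_matI) (auto simp: index_mat_adjoint[OF A] index_mat_adjoint[OF B])
qed

lemma mat_adjoint_one: "mat_adjoint (1\<^sub>m n) = (1\<^sub>m n :: complex mat)"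
  by (rule eq_matI) (auto simp: index_mat_adjoint[of _ n n])

lemma adjoint_cscalar_prod:
  fixes A :: "complex mat"
  assumes A: "A \<in> carrier_mat m n" and x: "x \<in> carrier_vec m" and y: "y \<in> carrier_vec n"
  shows "(A *\<^sub>v y) \<bullet>c x = y \<bullet>c (mat_adjoint A *\<^sub>v x)"
proof -
  have "(A *\<^sub>v y) \<bullet>c x = (\<Sum>l<m. \<Sum>k<n. cnj (x $ l) * A $$ (l, k) * y $ k)"
    using assms by (simp add: cscalar_prod_sum, simp add: scalar_prod_def lessThan_atLeast0
        sum_distrib_left mult.assoc)
  also have "\<dots> = (\<Sum>k<n. \<Sum>l<m. cnj (x $ l) * A $$ (l, k) * y $ k)"
    by (rule sum.swap)
  also have "\<dots> = y \<bullet>c (mat_adjoint A *\<^sub>v x)"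
    using assms
    by (simp add: cscalar_prod_sum, simp add: scalar_prod_def lessThan_atLeast0 row_def
        sum_distrib_left index_mat_adjoint[OF A] ac_simps)
  finally show ?thesis .
qed

lemma adjoint_cscalar_prod':
  fixes A :: "complex mat"
  assumes A: "A \<in> carrier_mat m n" and x: "x \<in> carrier_vec m" and y: "y \<in> carrier_vec n"
  shows "x \<bullet>c (A *\<^sub>v y) = (mat_adjoint A *\<^sub>v x) \<bullet>c y"
  using adjoint_cscalar_prod[OF mat_adjoint_carrier[OF A] y x] by simp

lemma cscalar_prod_conj:
  fixes u v :: "complex vec"
  assumes "u \<in> carrier_vec n" "v \<in> carrier_vec n"
  shows "cnj (u \<bullet>c v) = v \<bullet>c u"
  using assms by (simp add: cscalar_prod_sum mult.commute)

lemma cscalar_prod_add_left: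
  fixes u v w :: "complex vec"
  assumes "u \<in> carrier_vec n" "v \<in> carrier_vec n" "w \<in> carrier_vec n"
  shows "(u + v) \<bullet>c w = u \<bullet>c w + v \<bullet>c w"
  using assms by (simp add: cscalar_prod_sum algebra_simps sum.distrib)

lemma cscalar_prod_diff_left:
  fixes u v w :: "complex vec"
  assumes "u \<in> carrier_vec n" "v \<in> carrier_vec n" "w \<in> carrier_vec n"
  shows "(u - v) \<bullet>c w = u \<bullet>c w - v \<bullet>c w"
  using assms by (simp add: cscalar_prod_sum algebra_simps sum_subtractf)

lemma cscalar_prod_diff_right:
  fixes u v w :: "complex vec"
  assumes "u \<in> carrier_vec n" "v \<in> carrier_vec n" "w \<in> carrier_vec n"
  shows "u \<bullet>c (v - w) = u \<bullet>c v - u \<bullet>c w"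
  using assms by (simp add: cscalar_prod_sum algebra_simps sum_subtractf)

lemma cscalar_prod_smult_left:
  fixes u v :: "complex vec"
  assumes "u \<in> carrier_vec n" "v \<in> carrier_vec n"
  shows "(c \<cdot>\<^sub>v u) \<bullet>c v = c * (u \<bullet>c v)"
  using assms by (simp add: cscalar_prod_sum sum_distrib_left ac_simps)

lemma cscalar_prod_smult_right:
  fixes u v :: "complex vec"
  assumes "u \<in> carrier_vec n" "v \<in> carrier_vec n"
  shows "u \<bullet>c (c \<cdot>\<^sub>v v) = cnj c * (u \<bullet>c v)"
  using assms by (simp add: cscalar_prod_sum sum_distrib_left ac_simps)

lemma smult_zero_vec_complex: "c \<cdot>\<^sub>v 0\<^sub>v n = (0\<^sub>v n :: complex vec)"
  by (rule eq_vecI) auto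

lemma add_diff_vec:
  fixes u v :: "complex vec"
  assumes "u \<in> carrier_vec n" "v \<in> carrier_vec n"
  shows "u + (v - u) = v"
  using assms by (intro eq_vecI) auto

lemma diff_zero_vec_eq:
  fixes u v :: "complex vec"
  assumes "u \<in> carrier_vec n" "v \<in> carrier_vec n" "u - v = 0\<^sub>v n"
  shows "v = u"
proof (rule eq_vecI)
  fix i assume "i < dim_vec u"
  then show "v $ i = u $ i"
    using arg_cong[OF assms(3), of "\<lambda>x. x $ i"] assms(1,2) by simp
qed (use assms in auto)

text \<open>The rank-one operator |u><v|. Each step of the Gram-Schmidt induction below corrects an
  operator by one of these.\<close>

definition outer_prod :: "complex vec \<Rightarrow> complex vec \<Rightarrow> complex mat" where
  "outer_prod u v = mat (dim_vec u) (dim_vec v) (\<lambda>(i, j). u $ i * cnj (v $ j))"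

lemma outer_prod_carrier [simp]:
  "u \<in> carrier_vec m \<Longrightarrow> v \<in> carrier_vec n \<Longrightarrow> outer_prod u v \<in> carrier_mat m n"
  by (auto simp: outer_prod_def)

lemma index_outer_prod:
  "i < dim_vec u \<Longrightarrow> j < dim_vec v \<Longrightarrow> outer_prod u v $$ (i, j) = u $ i * cnj (v $ j)"
  "dim_row (outer_prod u v) = dim_vec u" "dim_col (outer_prod u v) = dim_vec v"
  by (auto simp: outer_prod_def)

lemma outer_prod_mult_vec:
  assumes "u \<in> carrier_vec m" "v \<in> carrier_vec n" "x \<in> carrier_vec n"
  shows "outer_prod u v *\<^sub>v x = (x \<bullet>c v) \<cdot>\<^sub>v u"
proof (rule eq_vecI)
  fix i assume i: "i < dim_vec ((x \<bullet>c v) \<cdot>\<^sub>v u)"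
  then have "(outer_prod u v *\<^sub>v x) $ i = (\<Sum>l<n. u $ i * cnj (v $ l) * x $ l)"
    using assms by (simp add: outer_prod_def scalar_prod_def lessThan_atLeast0)
  also have "\<dots> = (x \<bullet>c v) * u $ i"
    using assms by (simp add: cscalar_prod_sum sum_distrib_left ac_simps)
  finally show "(outer_prod u v *\<^sub>v x) $ i = ((x \<bullet>c v) \<cdot>\<^sub>v u) $ i"
    using i by simp
qed (use assms in \<open>simp add: outer_prod_def\<close>)

lemma mat_adjoint_add_outer_prod:
  assumes A: "A \<in> carrier_mat m n" and u: "u \<in> carrier_vec m" and v: "v \<in> carrier_vec n"
  shows "mat_adjoint (A + outer_prod u v) = mat_adjoint A + outer_prod v u"
proof -
  have "A + outer_prod u v \<in> carrier_mat m n" using assms by simp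
  note c = this mat_adjoint_carrier[OF this] mat_adjoint_carrier[OF A]
  show ?thesis
    using c u v A
    by (intro eq_matI)
      (auto simp: index_mat_adjoint[OF c(1)] index_mat_adjoint[OF A] index_outer_prod)
qed

text \<open>Lets operator identities be checked vector by vector, where a rank-one correction acts
  by a simple formula.\<close>

lemma eq_mat_by_mult_vec:
  fixes A B :: "complex mat"
  assumes A: "A \<in> carrier_mat m n" and B: "B \<in> carrier_mat m n"
    and eq: "\<And>x. x \<in> carrier_vec n \<Longrightarrow> A *\<^sub>v x = B *\<^sub>v x"
  shows "A = B"
proof (rule eq_matI)
  fix i j assume ij: "i < dim_row B" "j < dim_col B"
  have "(A *\<^sub>v unit_vec n j) $ i = (B *\<^sub>v unit_vec n j) $ i"
    using eq[of "unit_vec n j"] by simp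
  then show "A $$ (i, j) = B $$ (i, j)"
    using ij A B by simp
qed (use A B in auto)

text \<open>
  Gram--Schmidt in disguise.  Besides the wanted equations, the induction maintains
  \<open>W\<^sup>\<dagger> w\<^sub>i = E v\<^sub>i\<close> for all \<open>i\<close>, including those not yet treated; this is what makes the
  residuals \<open>v\<^sub>k - E v\<^sub>k\<close> and \<open>w\<^sub>k - W v\<^sub>k\<close> equally long.
\<close>

lemma gram_partial_isometry:
  fixes v w :: "'i \<Rightarrow> complex vec"
  assumes fin: "finite I"
    and v: "\<And>i. i \<in> I \<Longrightarrow> v i \<in> carrier_vec d"
    and w: "\<And>i. i \<in> I \<Longrightarrow> w i \<in> carrier_vec e"
    and gram: "\<And>i k. i \<in> I \<Longrightarrow> k \<in> I \<Longrightarrow> v i \<bullet>c v k = w i \<bullet>c w k"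
  obtains W where "W \<in> carrier_mat e d"
    "mat_adjoint W * W * (mat_adjoint W * W) = mat_adjoint W * W"
    "\<And>i. i \<in> I \<Longrightarrow> W *\<^sub>v v i = w i"
    "\<And>i. i \<in> I \<Longrightarrow> mat_adjoint W * W *\<^sub>v v i = v i"
proof -
  \<comment> \<open>With the choices made below, \<open>E\<close> is the orthogonal projector onto
    the span of the \<open>v i\<close> with \<open>i\<close> in \<open>J\<close>, and
    \<open>W\<close> is the partial isometry from this span onto that of the corresponding
    \<open>w i\<close>.\<close>
  have "\<exists>W E. W \<in> carrier_mat e d \<and> E \<in> carrier_mat d d \<and> mat_adjoint W * W = E \<and> E * E = E \<and>
      (\<forall>i\<in>I. mat_adjoint W *\<^sub>v w i = E *\<^sub>v v i) \<and> (\<forall>i\<in>J. W *\<^sub>v v i = w i \<and> E *\<^sub>v v i = v i)"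
    if "finite J" "J \<subseteq> I" for J
    using that
  proof (induction J rule: finite_induct)
    case empty
    have "mat_adjoint (0\<^sub>m e d) = (0\<^sub>m d e :: complex mat)"
      by (rule eq_matI) (auto simp: index_mat_adjoint[of _ e d])
    then show ?case
      using v w by (intro exI[of _ "0\<^sub>m e d"] exI[of _ "0\<^sub>m d d"]) auto
  next
    case (insert m J)
    then obtain W E where W: "W \<in> carrier_mat e d" and E: "E \<in> carrier_mat d d"
      and WE: "mat_adjoint W * W = E" and EE: "E * E = E"
      and Ww: "\<And>i. i \<in> I \<Longrightarrow> mat_adjoint W *\<^sub>v w i = E *\<^sub>v v i"
      and WJ: "\<And>i. i \<in> J \<Longrightarrow> W *\<^sub>v v i = w i" and EJ: "\<And>i. i \<in> J \<Longrightarrow> E *\<^sub>v v i = v i"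
      by auto
    have m: "m \<in> I" and JI: "\<And>i. i \<in> J \<Longrightarrow> i \<in> I" using insert.prems by auto
    note vm = v[OF m] and wm = w[OF m]
    have W': "mat_adjoint W \<in> carrier_mat d e" using W by simp
    have WWx: "mat_adjoint W *\<^sub>v (W *\<^sub>v x) = E *\<^sub>v x" if "x \<in> carrier_vec d" for x
      using that W W' WE by (metis assoc_mult_mat_vec)
    have EEx: "E *\<^sub>v (E *\<^sub>v x) = E *\<^sub>v x" if "x \<in> carrier_vec d" for x
      using that E EE by (metis assoc_mult_mat_vec)
    have Ec: "E *\<^sub>v x \<in> carrier_vec d" and Wc: "W *\<^sub>v x \<in> carrier_vec e" for x
      using carrier_matD(1)[OF E] carrier_matD(1)[OF W] by (simp_all add: carrier_vecI)
    have Esym: "(E *\<^sub>v y) \<bullet>c x = y \<bullet>c (E *\<^sub>v x)" if "x \<in> carrier_vec d" "y \<in> carrier_vec d" for x y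
    proof -
      have "(E *\<^sub>v y) \<bullet>c x = (W *\<^sub>v y) \<bullet>c (W *\<^sub>v x)"
        using WWx[OF that(2)] adjoint_cscalar_prod'[OF W Wc that(1)] by simp
      also have "\<dots> = y \<bullet>c (E *\<^sub>v x)"
        using WWx[OF that(1)] adjoint_cscalar_prod[OF W Wc that(2)] by simp
      finally show ?thesis .
    qed
    \<comment> \<open>What \<open>E\<close> and \<open>W\<close> do not yet account for in
      \<open>v m\<close> and \<open>w m\<close>. As \<open>r\<close> is orthogonal to the range of
      \<open>E\<close> and \<open>s\<close> to the range of \<open>W\<close>, a correction along
      \<open>r\<close> and \<open>s\<close> leaves the earlier equations intact.\<close>
    define r where "r = v m - E *\<^sub>v v m"
    define s where "s = w m - W *\<^sub>v v m"
    have r: "r \<in> carrier_vec d" and s: "s \<in> carrier_vec e"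
      unfolding r_def s_def using vm wm Ec Wc by auto
    have Er: "E *\<^sub>v r = 0\<^sub>v d"
      unfolding r_def using mult_minus_distrib_mat_vec[OF E vm Ec] EEx[OF vm] Ec by simp
    have Ws: "mat_adjoint W *\<^sub>v s = 0\<^sub>v d"
      unfolding s_def using mult_minus_distrib_mat_vec[OF W' wm Wc] WWx[OF vm] Ww[OF m] Ec by simp
    have sW: "(W *\<^sub>v x) \<bullet>c s = 0" if "x \<in> carrier_vec d" for x
      using adjoint_cscalar_prod[OF W s that] Ws that by simp
    have rE: "(E *\<^sub>v x) \<bullet>c r = 0" if "x \<in> carrier_vec d" for x
      using Esym[OF r that] Er that by simp
    \<comment> \<open>Used twice: \<open>i = m\<close> gives \<open>r\<close> and \<open>s\<close>
      equal length, and arbitrary \<open>i\<close> carries the invariant over to the corrected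
      operators.\<close>
    have sw: "w i \<bullet>c s = v i \<bullet>c r" if i: "i \<in> I" for i
    proof -
      have "w i \<bullet>c s = w i \<bullet>c w m - w i \<bullet>c (W *\<^sub>v v m)"
        unfolding s_def by (rule cscalar_prod_diff_right) (use w i wm Wc in auto)
      also have "w i \<bullet>c (W *\<^sub>v v m) = v i \<bullet>c (E *\<^sub>v v m)"
        using adjoint_cscalar_prod'[OF W w[OF i] vm] Ww[OF i] Esym[OF vm v[OF i]] by simp
      also have "w i \<bullet>c w m - v i \<bullet>c (E *\<^sub>v v m) = v i \<bullet>c r"
        unfolding r_def gram[OF i m, symmetric]
        by (rule cscalar_prod_diff_right[symmetric]) (use v i vm Ec in auto)
      finally show ?thesis .
    qed
    have rr: "v m \<bullet>c r = r \<bullet>c r"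
      using cscalar_prod_diff_left[OF vm Ec r, of "v m"] rE[OF vm] unfolding r_def by simp
    have ss: "s \<bullet>c s = r \<bullet>c r"
      using cscalar_prod_diff_left[OF wm Wc s, of "v m"] sW[OF vm] sw[OF m] rr
      unfolding s_def by simp
    show ?case
    proof (cases "r = 0\<^sub>v d")
      case True
      then have "s \<bullet>c s = 0" using ss by simp
      then have s0: "s = 0\<^sub>v e" using s by simp
      have "E *\<^sub>v v m = v m"
        using True unfolding r_def by (rule diff_zero_vec_eq[OF vm Ec])
      moreover have "W *\<^sub>v v m = w m"
        using s0 unfolding s_def by (rule diff_zero_vec_eq[OF wm Wc])
      ultimately have "\<forall>i\<in>insert m J. W *\<^sub>v v i = w i \<and> E *\<^sub>v v i = v i"
        using WJ EJ by blast
      then show ?thesis using W E WE EE Ww by blast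
    next
      case False
      define a where "a = r \<bullet>c r"
      have a0: "a \<noteq> 0" using False r unfolding a_def by simp
      have ca: "cnj a = a" unfolding a_def using cscalar_prod_conj[OF r r] .
      \<comment> \<open>The factor \<open>1 / a\<close> makes \<open>outer_prod t r\<close> the
        orthogonal projector onto the line of \<open>r\<close>, while \<open>outer_prod s t\<close>
        sends \<open>r\<close> to \<open>s\<close>. The latter is isometric on that line because
        \<open>r\<close> and \<open>s\<close> are equally long.\<close>
      define t where "t = (1 / a) \<cdot>\<^sub>v r"
      have t: "t \<in> carrier_vec d" using r unfolding t_def by simp
      have xt: "x \<bullet>c t = (x \<bullet>c r) / a" if "x \<in> carrier_vec d" for x
        unfolding t_def using cscalar_prod_smult_right[OF that r, of "1 / a"] ca by simp
      define W1 where "W1 = W + outer_prod s t"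
      define E1 where "E1 = E + outer_prod t r"
      have W1: "W1 \<in> carrier_mat e d" and E1: "E1 \<in> carrier_mat d d"
        unfolding W1_def E1_def using W E s t r by auto
      have W1': "mat_adjoint W1 = mat_adjoint W + outer_prod t s"
        unfolding W1_def by (rule mat_adjoint_add_outer_prod[OF W s t])
      have W1x: "W1 *\<^sub>v x = W *\<^sub>v x + ((x \<bullet>c r) / a) \<cdot>\<^sub>v s" if "x \<in> carrier_vec d" for x
        unfolding W1_def using add_mult_distrib_mat_vec[OF W outer_prod_carrier[OF s t] that]
          outer_prod_mult_vec[OF s t that] xt[OF that] by simp
      have E1x: "E1 *\<^sub>v x = E *\<^sub>v x + (x \<bullet>c r) \<cdot>\<^sub>v t" if "x \<in> carrier_vec d" for x
        unfolding E1_def using add_mult_distrib_mat_vec[OF E outer_prod_carrier[OF t r] that]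
          outer_prod_mult_vec[OF t r that] by simp
      have W1'x: "mat_adjoint W1 *\<^sub>v y = mat_adjoint W *\<^sub>v y + (y \<bullet>c s) \<cdot>\<^sub>v t"
        if "y \<in> carrier_vec e" for y
        unfolding W1' using add_mult_distrib_mat_vec[OF W' outer_prod_carrier[OF t s] that]
          outer_prod_mult_vec[OF t s that] by simp
      have "mat_adjoint W1 *\<^sub>v (W1 *\<^sub>v x) = E1 *\<^sub>v x" if x: "x \<in> carrier_vec d" for x
      proof -
        let ?c = "(x \<bullet>c r) / a"
        have cs: "?c \<cdot>\<^sub>v s \<in> carrier_vec e" using s by simp
        have "(W1 *\<^sub>v x) \<bullet>c s = ?c * a"
          unfolding W1x[OF x] using cscalar_prod_add_left[OF Wc cs s, of x] sW[OF x]
            cscalar_prod_smult_left[OF s s, of ?c] ss a_def by simp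
        then have 1: "(W1 *\<^sub>v x) \<bullet>c s = x \<bullet>c r" using a0 by simp
        have "mat_adjoint W *\<^sub>v (W1 *\<^sub>v x) = E *\<^sub>v x + ?c \<cdot>\<^sub>v 0\<^sub>v d"
          unfolding W1x[OF x] using mult_add_distrib_mat_vec[OF W' Wc cs, of x]
            mult_mat_vec[OF W' s, of ?c] WWx[OF x] Ws by simp
        then have 2: "mat_adjoint W *\<^sub>v (W1 *\<^sub>v x) = E *\<^sub>v x"
          using Ec[of x] by (simp add: smult_zero_vec_complex)
        show ?thesis
          using W1'x[OF mult_mat_vec_carrier[OF W1 x]] 1 2 E1x[OF x] by simp
      qed
      then have WE1: "mat_adjoint W1 * W1 = E1"
        using assoc_mult_mat_vec[OF mat_adjoint_carrier[OF W1] W1] E1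
        by (intro eq_mat_by_mult_vec[OF mult_carrier_mat[OF mat_adjoint_carrier[OF W1] W1]]) metis+
      have Et: "E *\<^sub>v t = 0\<^sub>v d"
        unfolding t_def using mult_mat_vec[OF E r, of "1 / a"] Er by (simp add: smult_zero_vec_complex)
      have tr: "t \<bullet>c r = 1"
        unfolding t_def using cscalar_prod_smult_left[OF r r, of "1 / a"] a0 a_def by simp
      have "E1 *\<^sub>v (E1 *\<^sub>v x) = E1 *\<^sub>v x" if x: "x \<in> carrier_vec d" for x
      proof -
        let ?c = "x \<bullet>c r"
        have ct: "?c \<cdot>\<^sub>v t \<in> carrier_vec d" using t by simp
        have "(E1 *\<^sub>v x) \<bullet>c r = ?c"
          unfolding E1x[OF x] using cscalar_prod_add_left[OF Ec ct r, of x] rE[OF x]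
            cscalar_prod_smult_left[OF t r, of ?c] tr by simp
        moreover have "E *\<^sub>v (E1 *\<^sub>v x) = E *\<^sub>v x + ?c \<cdot>\<^sub>v 0\<^sub>v d"
          unfolding E1x[OF x] using mult_add_distrib_mat_vec[OF E Ec ct, of x]
            mult_mat_vec[OF E t, of ?c] EEx[OF x] Et by simp
        ultimately show ?thesis
          using E1x[OF mult_mat_vec_carrier[OF E1 x]] E1x[OF x] Ec[of x] by (simp add: smult_zero_vec_complex)
      qed
      then have EE1: "E1 * E1 = E1"
        using assoc_mult_mat_vec[OF E1 E1] E1
        by (intro eq_mat_by_mult_vec[OF mult_carrier_mat[OF E1 E1]]) metis+
      have Ww1: "mat_adjoint W1 *\<^sub>v w i = E1 *\<^sub>v v i" if "i \<in> I" for i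
        using W1'x[OF w[OF that]] E1x[OF v[OF that]] Ww[OF that] sw[OF that] by simp
      have rJ: "v i \<bullet>c r = 0" if "i \<in> J" for i
        using rE[OF v[OF JI[OF that]]] EJ[OF that] by simp
      have WJ1: "W1 *\<^sub>v v i = w i" "E1 *\<^sub>v v i = v i" if "i \<in> J" for i
        using W1x[OF v[OF JI[OF that]]] E1x[OF v[OF JI[OF that]]] rJ[OF that] WJ[OF that] EJ[OF that]
          s t w[OF JI[OF that]] v[OF JI[OF that]] by auto
      have "W1 *\<^sub>v v m = W *\<^sub>v v m + s"
        using W1x[OF vm] rr a0 a_def by simp
      then have Wm1: "W1 *\<^sub>v v m = w m"
        unfolding s_def by (simp only: add_diff_vec[OF Wc wm])
      have "E1 *\<^sub>v v m = E *\<^sub>v v m + r"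
        using E1x[OF vm] rr a0 by (simp add: t_def smult_smult_assoc a_def)
      then have Em1: "E1 *\<^sub>v v m = v m"
        unfolding r_def by (simp only: add_diff_vec[OF Ec vm])
      have "\<forall>i\<in>insert m J. W1 *\<^sub>v v i = w i \<and> E1 *\<^sub>v v i = v i"
        using WJ1 Wm1 Em1 by blast
      then show ?thesis using W1 E1 WE1 EE1 Ww1 by blast
    qed
  qed
  from this[OF fin order_refl] show ?thesis
    using that by metis
qed

subsection \<open>Product states\<close>

text \<open>The factors form a function rather than a list, so that acting on factor
  \<open>j\<close> becomes a function update; values at or beyond \<open>length ds\<close> have no
  influence.\<close>

definition tensor :: "nat list \<Rightarrow> (nat \<Rightarrow> complex vec) \<Rightarrow> state" where
  "tensor ds v = product_state ds (map v [0..<length ds])"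

lemma tensor_apply:
  "tensor ds v ix = (if ix \<in> multi_indices ds then \<Prod>j<length ds. v j $ (ix ! j) else 0)"
  by (simp add: tensor_def product_state_def)

lemma tensor_cong:
  "(\<And>j. j < length ds \<Longrightarrow> v j = w j) \<Longrightarrow> tensor ds v = tensor ds w"
  by (rule ext) (simp add: tensor_apply)

lemma tensor_in_tensor_space: "tensor ds v \<in> tensor_space ds"
  by (simp add: tensor_space_def tensor_apply)

lemma is_product_state_tensor:
  assumes "is_product_state ds \<psi>"
  obtains v where "\<And>j. j < length ds \<Longrightarrow> v j \<in> carrier_vec (ds ! j)" "\<psi> = tensor ds v"
proof -
  obtain vs where vs: "length vs = length ds" "\<forall>j<length ds. vs ! j \<in> carrier_vec (ds ! j)"
    "\<psi> = product_state ds vs"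
    using assms unfolding is_product_state_def by auto
  have "map ((!) vs) [0..<length ds] = vs"
    using vs(1) by (metis map_nth)
  with vs show ?thesis by (intro that[of "(!) vs"]) (auto simp: tensor_def)
qed

text \<open>Brings sums over multi-indices into the shape of the distributive law
  \<open>prod_sum_PiE\<close>. The \<open>restrict\<close> is there because members of
  \<open>PiE\<close> are \<open>undefined\<close> outside the index set.\<close>

lemma bij_betw_multi_indices:
  "bij_betw (\<lambda>ix. restrict ((!) ix) {..<length ds}) (multi_indices ds)
     (PiE {..<length ds} (\<lambda>j. {..<ds ! j}))"
proof (rule bij_betwI[where g = "\<lambda>g. map g [0..<length ds]"])
  fix ix assume "ix \<in> multi_indices ds"
  then show "map (restrict ((!) ix) {..<length ds}) [0..<length ds] = ix"
    by (intro nth_equalityI) (simp_all add: multi_indices_def)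
next
  fix g assume g: "g \<in> PiE {..<length ds} (\<lambda>j. {..<ds ! j})"
  show "restrict ((!) (map g [0..<length ds])) {..<length ds} = g"
  proof
    fix j show "restrict ((!) (map g [0..<length ds])) {..<length ds} j = g j"
      using PiE_arb[OF g, of j] by (cases "j < length ds") simp_all
  qed
next
  show "(\<lambda>ix. restrict ((!) ix) {..<length ds}) \<in>
      multi_indices ds \<rightarrow> PiE {..<length ds} (\<lambda>j. {..<ds ! j})"
    by (auto simp: multi_indices_def)
  show "(\<lambda>g. map g [0..<length ds]) \<in>
      PiE {..<length ds} (\<lambda>j. {..<ds ! j}) \<rightarrow> multi_indices ds"
  proof
    fix g assume g: "g \<in> PiE {..<length ds} (\<lambda>j. {..<ds ! j})"
    have "g j < ds ! j" if "j < length ds" for j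
      using PiE_mem[OF g, of j] that by simp
    then show "map g [0..<length ds] \<in> multi_indices ds"
      by (simp add: multi_indices_def)
  qed
qed

lemma finite_multi_indices [simp]: "finite (multi_indices ds)"
  using bij_betw_finite[OF bij_betw_multi_indices[of ds]] by (simp add: finite_PiE)

lemma sum_multi_indices_prod:
  fixes f :: "nat \<Rightarrow> nat \<Rightarrow> complex"
  shows "(\<Sum>ix\<in>multi_indices ds. \<Prod>j<length ds. f j (ix ! j)) = (\<Prod>j<length ds. \<Sum>l<ds ! j. f j l)"
proof -
  have "(\<Prod>j<length ds. \<Sum>l<ds ! j. f j l) =
      (\<Sum>g\<in>PiE {..<length ds} (\<lambda>j. {..<ds ! j}). \<Prod>j<length ds. f j (g j))"
    by (rule prod_sum_PiE) auto
  also have "\<dots> = (\<Sum>ix\<in>multi_indices ds. \<Prod>j<length ds. f j (restrict ((!) ix) {..<length ds} j))"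
    by (rule sum.reindex_bij_betw[OF bij_betw_multi_indices, symmetric])
  finally show ?thesis by simp
qed

text \<open>The arguments change places because \<open>inner_prod\<close> is conjugate-linear in the
  first argument and \<open>\<bullet>c\<close> in the second.\<close>

lemma inner_prod_tensor:
  assumes "\<And>j. j < length ds \<Longrightarrow> v j \<in> carrier_vec (ds ! j)"
    and "\<And>j. j < length ds \<Longrightarrow> w j \<in> carrier_vec (ds ! j)"
  shows "inner_prod ds (tensor ds v) (tensor ds w) = (\<Prod>j<length ds. w j \<bullet>c v j)"
proof -
  have "inner_prod ds (tensor ds v) (tensor ds w) =
      (\<Sum>ix\<in>multi_indices ds. \<Prod>j<length ds. cnj (v j $ (ix ! j)) * w j $ (ix ! j))"
    by (simp add: inner_prod_def tensor_apply prod.distrib)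
  also have "\<dots> = (\<Prod>j<length ds. \<Sum>l<ds ! j. cnj (v j $ l) * w j $ l)"
    by (rule sum_multi_indices_prod)
  also have "\<dots> = (\<Prod>j<length ds. w j \<bullet>c v j)"
    using assms by (intro prod.cong) (simp_all add: cscalar_prod_sum carrier_vecD[OF assms(1)])
  finally show ?thesis .
qed

section \<open>Norms, scaling, and local operators on product states\<close>

lemma inner_prod_scale:
  "inner_prod ds (\<lambda>ix. a * \<phi> ix) (\<lambda>ix. b * \<psi> ix) = cnj a * b * inner_prod ds \<phi> \<psi>"
  by (simp add: inner_prod_def sum_distrib_left ac_simps)

lemma inner_prod_self_nonneg: "Re (inner_prod ds \<phi> \<phi>) \<ge> 0" "Im (inner_prod ds \<phi> \<phi>) = 0"
  unfolding inner_prod_def Re_sum Im_sum by (intro sum_nonneg, simp) (simp add: mult.commute)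

lemma inner_prod_self: "inner_prod ds \<phi> \<phi> = complex_of_real ((state_norm ds \<phi>)\<^sup>2)"
  using inner_prod_self_nonneg[of ds \<phi>] by (simp add: complex_eq_iff state_norm_def)

lemma state_norm_nonneg: "state_norm ds \<phi> \<ge> 0"
  using inner_prod_self_nonneg(1) by (simp add: state_norm_def)

lemma state_norm_eq_0:
  assumes "\<phi> \<in> tensor_space ds" "state_norm ds \<phi> = 0"
  shows "\<phi> = zero_state"
proof -
  have "(\<Sum>ix\<in>multi_indices ds. (cmod (\<phi> ix))\<^sup>2) = Re (inner_prod ds \<phi> \<phi>)"
    by (simp add: inner_prod_def cmod_def power2_eq_square)
  also have "\<dots> = 0"
    using assms(2) by (simp add: state_norm_def)
  finally have "\<forall>ix\<in>multi_indices ds. \<phi> ix = 0"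
    by (simp add: sum_nonneg_eq_0_iff)
  then show ?thesis
    using assms(1) by (auto simp: tensor_space_def zero_state_def fun_eq_iff)
qed

lemma state_norm_zero_state [simp]: "state_norm ds zero_state = 0"
  by (simp add: state_norm_def inner_prod_def zero_state_def)

lemma state_norm_scale: "state_norm ds (\<lambda>ix. c * \<phi> ix) = cmod c * state_norm ds \<phi>"
proof -
  have "Re (inner_prod ds (\<lambda>ix. c * \<phi> ix) (\<lambda>ix. c * \<phi> ix)) = (cmod c * state_norm ds \<phi>)\<^sup>2"
    unfolding inner_prod_scale inner_prod_self
    by (simp add: cmod_def power_mult_distrib flip: of_real_power of_real_mult)
       (simp add: power2_eq_square)
  then show ?thesis
    by (simp add: state_norm_def[of ds "\<lambda>ix. c * \<phi> ix"] state_norm_def[of ds \<phi>]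
        inner_prod_self_nonneg)
qed

text \<open>Makes intermediate normalizations disappear: they contribute positive factors only, so
  normalizing once at the end gives the same vector. A phase would not cancel.\<close>

lemma normalize_state_scale:
  assumes "c > 0"
  shows "normalize_state ds (\<lambda>ix. complex_of_real c * \<phi> ix) = normalize_state ds \<phi>"
  using assms by (simp add: normalize_state_def state_norm_scale fun_eq_iff)

lemma local_op_scale: "local_op ds j A (\<lambda>ix. c * \<phi> ix) = (\<lambda>ix. c * local_op ds j A \<phi> ix)"
  by (simp add: local_op_def fun_eq_iff sum_distrib_left ac_simps)

lemma local_op_zero_state [simp]: "local_op ds j A zero_state = zero_state"
  by (simp add: local_op_def zero_state_def fun_eq_iff)

lemma multi_indices_update:
  assumes "ix \<in> multi_indices ds" "j < length ds" "l < ds ! j"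
  shows "ix[j := l] \<in> multi_indices ds"
  using assms by (auto simp: multi_indices_def nth_list_update)

text \<open>Serves to evaluate \<open>local_op\<close> on a product vector and, in the other
  direction, to read a single factor off the coordinates along one axis.\<close>

lemma tensor_update:
  assumes ix: "ix \<in> multi_indices ds" and j: "j < length ds" and l: "l < ds ! j"
  shows "tensor ds v (ix[j := l]) = v j $ l * (\<Prod>i\<in>{..<length ds} - {j}. v i $ (ix ! i))"
proof -
  have "length ix = length ds" using ix by (simp add: multi_indices_def)
  then have "tensor ds v (ix[j := l]) =
      v j $ l * (\<Prod>i\<in>{..<length ds} - {j}. v i $ (ix[j := l] ! i))"
    using multi_indices_update[OF ix j l] j by (simp add: tensor_apply prod.remove[of _ j])
  also have "(\<Prod>i\<in>{..<length ds} - {j}. v i $ (ix[j := l] ! i)) =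
      (\<Prod>i\<in>{..<length ds} - {j}. v i $ (ix ! i))"
    by (rule prod.cong) auto
  finally show ?thesis .
qed

lemma local_op_tensor:
  assumes j: "j < length ds" and A: "A \<in> carrier_mat (ds ! j) (ds ! j)"
    and v: "v j \<in> carrier_vec (ds ! j)"
  shows "local_op ds j A (tensor ds v) = tensor ds (v(j := A *\<^sub>v v j))"
proof
  fix ix
  have [simp]: "dim_row A = ds ! j" "dim_col A = ds ! j" using A by auto
  show "local_op ds j A (tensor ds v) ix = tensor ds (v(j := A *\<^sub>v v j)) ix"
  proof (cases "ix \<in> multi_indices ds")
    case True
    have ixj: "ix ! j < ds ! j"
      using True j by (auto simp: multi_indices_def)
    let ?r = "\<Prod>i\<in>{..<length ds} - {j}. v i $ (ix ! i)"
    have *: "tensor ds v (ix[j := l]) = v j $ l * ?r" if "l < ds ! j" for l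
      by (rule tensor_update[OF True j that])
    have "local_op ds j A (tensor ds v) ix = (\<Sum>l<ds ! j. A $$ (ix ! j, l) * v j $ l) * ?r"
      using True * by (simp add: local_op_def sum_distrib_right mult.assoc)
    also have "(\<Sum>l<ds ! j. A $$ (ix ! j, l) * v j $ l) = (A *\<^sub>v v j) $ (ix ! j)"
      using ixj v by (simp add: scalar_prod_def lessThan_atLeast0)
    also have "(A *\<^sub>v v j) $ (ix ! j) * ?r = tensor ds (v(j := A *\<^sub>v v j)) ix"
      using True j by (simp add: tensor_apply prod.remove[of _ j])
    finally show ?thesis .
  qed (simp add: local_op_def tensor_apply)
qed

lemma tensor_smult:
  assumes "\<And>j. j < length ds \<Longrightarrow> v j \<in> carrier_vec (ds ! j)"
  shows "tensor ds (\<lambda>j. c j \<cdot>\<^sub>v v j) = (\<lambda>ix. (\<Prod>j<length ds. c j) * tensor ds v ix)"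
proof
  fix ix show "tensor ds (\<lambda>j. c j \<cdot>\<^sub>v v j) ix = (\<Prod>j<length ds. c j) * tensor ds v ix"
  proof (cases "ix \<in> multi_indices ds")
    case True
    have "(c j \<cdot>\<^sub>v v j) $ (ix ! j) = c j * v j $ (ix ! j)" if "j < length ds" for j
    proof -
      have "ix ! j < dim_vec (v j)"
        using True that carrier_vecD[OF assms[OF that]] by (simp add: multi_indices_def)
      then show ?thesis by simp
    qed
    then have "(\<Prod>j<length ds. (c j \<cdot>\<^sub>v v j) $ (ix ! j)) =
        (\<Prod>j<length ds. c j * v j $ (ix ! j))"
      by (intro prod.cong) auto
    with True show ?thesis
      by (simp only: tensor_apply if_True prod.distrib)
  qed (simp add: tensor_apply)
qed

lemma tensor_eq_zero_state:
  assumes "j < length ds" "v j = 0\<^sub>v (ds ! j)"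
  shows "tensor ds v = zero_state"
proof
  fix ix
  have "(\<Prod>j<length ds. v j $ (ix ! j)) = 0" if "ix \<in> multi_indices ds"
    using assms that by (intro prod_zero bexI[of _ j]) (auto simp: multi_indices_def)
  then show "tensor ds v ix = zero_state ix"
    by (simp add: tensor_apply zero_state_def)
qed

text \<open>Comparing coordinates along the \<open>j\<close>-th axis through a nonzero entry.\<close>

lemma tensor_proportional:
  assumes v: "\<And>j. j < length ds \<Longrightarrow> v j \<in> carrier_vec (ds ! j)"
    and w: "\<And>j. j < length ds \<Longrightarrow> w j \<in> carrier_vec (ds ! j)"
    and eq: "tensor ds w = (\<lambda>ix. c * tensor ds v ix)" and c: "c \<noteq> 0"
    and nz: "tensor ds v \<noteq> zero_state" and j: "j < length ds"
  obtains l where "w j = l \<cdot>\<^sub>v v j"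
proof -
  obtain ix where ix: "tensor ds v ix \<noteq> 0"
    using nz by (auto simp: zero_state_def fun_eq_iff)
  then have mi: "ix \<in> multi_indices ds" by (auto simp: tensor_apply split: if_splits)
  then have ixj: "ix ! j < ds ! j"
    using j by (auto simp: multi_indices_def)
  define r where "r u = (\<Prod>i\<in>{..<length ds} - {j}. u i $ (ix ! i))" for u :: "nat \<Rightarrow> complex vec"
  have *: "tensor ds u (ix[j := l]) = u j $ l * r u" if "l < ds ! j" for l u
    unfolding r_def by (rule tensor_update[OF mi j that])
  have **: "w j $ l * r w = c * (v j $ l * r v)" if "l < ds ! j" for l
    using *[OF that] eq by metis
  \<comment> \<open>At \<open>l = ix ! j\<close> the right-hand side of the preceding equation is
    \<open>c\<close> times the nonzero entry at \<open>ix\<close>; this permits the division by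
    \<open>r w\<close>.\<close>
  have "r w \<noteq> 0"
    using **[OF ixj] *[OF ixj, of v] ix c by auto
  then have "w j = (c * r v / r w) \<cdot>\<^sub>v v j"
    using v[OF j] w[OF j] **
    by (intro eq_vecI) (auto simp: field_simps)
  then show ?thesis by (rule that)
qed

subsection \<open>Undoing local operations\<close>

lemma guess_prob_zero_state: "guess_prob p ds s zero_state = 0"
  by (induction p arbitrary: ds) (simp_all add: sum_list_0)

text \<open>The given protocol announces elements of the basis, whereas the new one must announce
  the remaining states. The relabelling may merge other guesses as long as none of them is merged
  with \<open>s\<close>.\<close>

lemma guess_prob_map_locc:
  assumes "\<And>t. f t = f s \<longleftrightarrow> t = s"
  shows "guess_prob (map_locc f p) ds (f s) \<phi> = guess_prob p ds s \<phi>"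
  using assms by (induction p arbitrary: ds \<phi>) auto

lemma valid_locc_map_locc: "valid_locc (map_locc f p) ds = valid_locc p ds"
  by (induction p arbitrary: ds) auto

text \<open>As \<open>mat_adjoint W * W\<close> is a projector, so is its complement, whose adjoint
  times itself is again the complement; the two contributions add up to the identity. Both Kraus
  operators belong to one outcome, since nothing is to be learned from this operation.\<close>

lemma local_instrument_partial_isometry:
  assumes W: "W \<in> carrier_mat d d"
    and proj: "mat_adjoint W * W * (mat_adjoint W * W) = mat_adjoint W * W"
  shows "local_instrument d 1 (\<lambda>_. d) (\<lambda>_. [W, 1\<^sub>m d - mat_adjoint W * W])"
proof -
  define E where "E = mat_adjoint W * W"
  define F where "F = 1\<^sub>m d - E"
  have E: "E \<in> carrier_mat d d" and F: "F \<in> carrier_mat d d"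
    using W mat_adjoint_carrier[OF W] by (auto simp: E_def F_def)
  have "mat_adjoint E = E"
    unfolding E_def using mat_adjoint_mult[OF mat_adjoint_carrier[OF W] W] by simp
  then have "mat_adjoint F = F"
    unfolding F_def using mat_adjoint_minus[OF one_carrier_mat E] by (simp add: mat_adjoint_one)
  moreover have "F * F = F"
  proof -
    have "F * F = 1\<^sub>m d * F - E * F"
      unfolding F_def by (rule minus_mult_distrib_mat) (use E in auto)
    also have "E * F = E * 1\<^sub>m d - E * E"
      unfolding F_def by (rule mult_minus_distrib_mat) (use E in auto)
    also have "\<dots> = 0\<^sub>m d d"
      using E proj by (simp add: E_def[symmetric])
    also have "1\<^sub>m d * F - 0\<^sub>m d d = F"
      using F by (intro eq_matI) auto
    finally show ?thesis .
  qed
  ultimately have "mat d d (\<lambda>(a, b). E $$ (a, b) + (mat_adjoint F * F) $$ (a, b)) = 1\<^sub>m d"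
    using E by (intro eq_matI) (auto simp: F_def)
  then show ?thesis
    unfolding local_instrument_def using W F by (simp add: E_def[symmetric] F_def[symmetric])
qed

text \<open>Each party's isometry is the same for all \<open>i\<close>, so the states can be
  restored without knowing which of them was chosen. Then \<open>p\<close> takes over.\<close>

lemma undo_protocol:
  fixes x y :: "'i \<Rightarrow> nat \<Rightarrow> complex vec" and p :: "'a locc"
  assumes fin: "finite I"
    and x: "\<And>i j. i \<in> I \<Longrightarrow> j < length ds \<Longrightarrow> x i j \<in> carrier_vec (ds ! j)"
    and y: "\<And>i j. i \<in> I \<Longrightarrow> j < length ds \<Longrightarrow> y i j \<in> carrier_vec (ds ! j)"
    and gram: "\<And>i k j. i \<in> I \<Longrightarrow> k \<in> I \<Longrightarrow> j < length ds \<Longrightarrow> x i j \<bullet>c x k j = y i j \<bullet>c y k j"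
    and p: "valid_locc p ds"
  obtains q where "valid_locc q ds"
    "\<And>i t. i \<in> I \<Longrightarrow> guess_prob q ds t (tensor ds (x i)) = guess_prob p ds t (tensor ds (y i))"
proof -
  \<comment> \<open>Hybrid states: parties below \<open>m\<close> still hold their \<open>x\<close>
    factor, the others already their \<open>y\<close> factor. The induction step puts the operation
    of party \<open>m\<close> in front of \<open>q\<close>, so the parties act in descending
    order.\<close>
  have "\<exists>q. valid_locc q ds \<and> (\<forall>i\<in>I. \<forall>t. guess_prob q ds t
      (tensor ds (\<lambda>j. if j < m then x i j else y i j)) = guess_prob p ds t (tensor ds (y i)))"
    if "m \<le> length ds" for m
    using that
  proof (induction m)
    case 0
    show ?case using p by auto
  next
    case (Suc m)
    then obtain q where q: "valid_locc q ds"
      and qp: "\<And>i t. i \<in> I \<Longrightarrow> guess_prob q ds t (tensor ds (\<lambda>j. if j < m then x i j else y i j)) =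
        guess_prob p ds t (tensor ds (y i))"
      by auto
    have m: "m < length ds" using Suc.prems by simp
    define d where "d = ds ! m"
    obtain W where W: "W \<in> carrier_mat d d"
      and proj: "mat_adjoint W * W * (mat_adjoint W * W) = mat_adjoint W * W"
      and Wx: "\<And>i. i \<in> I \<Longrightarrow> W *\<^sub>v x i m = y i m"
      and Ex: "\<And>i. i \<in> I \<Longrightarrow> mat_adjoint W * W *\<^sub>v x i m = x i m"
      using gram_partial_isometry[OF fin, of "\<lambda>i. x i m" d "\<lambda>i. y i m" d] x y gram m
      unfolding d_def by blast
    define F where "F = 1\<^sub>m d - mat_adjoint W * W"
    have WW: "mat_adjoint W * W \<in> carrier_mat d d"
      using mat_adjoint_carrier[OF W] W by (rule mult_carrier_mat)
    have F: "F \<in> carrier_mat d d"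
      unfolding F_def by (rule minus_carrier_mat[OF WW])
    let ?q = "Operate m 1 (\<lambda>_. d) (\<lambda>_. [W, F]) (\<lambda>_. q)"
    have "valid_locc ?q ds"
      using q m local_instrument_partial_isometry[OF W proj] by (simp add: F_def d_def)
    moreover have "guess_prob ?q ds t (tensor ds (\<lambda>j. if j < Suc m then x i j else y i j)) =
        guess_prob p ds t (tensor ds (y i))" if i: "i \<in> I" for i t
    proof -
      let ?v = "\<lambda>j. if j < Suc m then x i j else y i j"
      have xm: "x i m \<in> carrier_vec d" using x[OF i m] unfolding d_def .
      have vm: "?v m \<in> carrier_vec (ds ! m)" using x[OF i m] by simp
      \<comment> \<open>The vector \<open>x i m\<close> lies in the initial space of
        \<open>W\<close>, so the branch of the second Kraus operator carries the zero vector and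
        adds nothing to the probability.\<close>
      have "F *\<^sub>v x i m = 0\<^sub>v d"
        unfolding F_def using minus_mult_distrib_mat_vec[OF one_carrier_mat WW xm] Ex[OF i] xm by simp
      then have "local_op ds m F (tensor ds ?v) = zero_state"
        using local_op_tensor[OF m F[unfolded d_def], of ?v] vm m
        by (simp add: tensor_eq_zero_state d_def)
      moreover have "local_op ds m W (tensor ds ?v) = tensor ds (\<lambda>j. if j < m then x i j else y i j)"
        unfolding local_op_tensor[where v = ?v, OF m W[unfolded d_def] vm]
        by (rule tensor_cong) (use Wx[OF i] in auto)
      moreover have "ds[m := d] = ds" unfolding d_def by simp
      ultimately show ?thesis
        using qp[OF i] by (simp add: guess_prob_zero_state)
    qed
    ultimately show ?case by blast
  qed
  from this[OF order_refl] obtain q where q: "valid_locc q ds"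
    and qp: "\<And>i t. i \<in> I \<Longrightarrow> guess_prob q ds t
      (tensor ds (\<lambda>j. if j < length ds then x i j else y i j)) = guess_prob p ds t (tensor ds (y i))"
    by auto
  have "tensor ds (\<lambda>j. if j < length ds then x i j else y i j) = tensor ds (x i)" for i
    by (rule tensor_cong) simp
  with q qp show ?thesis by (intro that) auto
qed

section \<open>Normalized factors, and how a local operator changes their inner products\<close>

definition vec_norm :: "complex vec \<Rightarrow> real" where
  "vec_norm v = sqrt (Re (v \<bullet>c v))"

definition unit :: "complex vec \<Rightarrow> complex vec" where
  "unit v = (1 / complex_of_real (vec_norm v)) \<cdot>\<^sub>v v"

lemma unit_carrier [simp]: "v \<in> carrier_vec n \<Longrightarrow> unit v \<in> carrier_vec n"
  by (simp add: unit_def)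

lemma cscalar_prod_self: "v \<bullet>c v = complex_of_real ((vec_norm v)\<^sup>2)"
proof -
  have "Re (v \<bullet>c v) \<ge> 0" "Im (v \<bullet>c v) = 0"
    unfolding cscalar_prod_sum Re_sum Im_sum by (intro sum_nonneg, simp) (simp add: mult.commute)
  then show ?thesis by (simp add: vec_norm_def complex_eq_iff)
qed

lemma vec_norm_nonneg [simp]: "vec_norm v \<ge> 0"
proof -
  have "Re (v \<bullet>c v) \<ge> 0"
    unfolding cscalar_prod_sum Re_sum by (intro sum_nonneg) simp
  then show ?thesis by (simp add: vec_norm_def)
qed

lemma vec_norm_pos:
  assumes "v \<in> carrier_vec n" "v \<noteq> 0\<^sub>v n"
  shows "vec_norm v > 0"
proof -
  have "v \<bullet>c v \<noteq> 0" using assms by simp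
  then have "vec_norm v \<noteq> 0" unfolding cscalar_prod_self by auto
  then show ?thesis using vec_norm_nonneg[of v] by linarith
qed

lemma unit_cscalar_prod:
  assumes "u \<in> carrier_vec n" "v \<in> carrier_vec n"
  shows "unit u \<bullet>c unit v = (u \<bullet>c v) / (vec_norm u * vec_norm v)"
proof -
  have "unit u \<bullet>c unit v = cnj (1 / complex_of_real (vec_norm v)) * (unit u \<bullet>c v)"
    unfolding unit_def[of v] by (rule cscalar_prod_smult_right[of _ n]) (use assms in auto)
  also have "unit u \<bullet>c v = (1 / complex_of_real (vec_norm u)) * (u \<bullet>c v)"
    unfolding unit_def by (rule cscalar_prod_smult_left[OF assms])
  finally show ?thesis by simp
qed

text \<open>
  The eigenvalue of \<open>u\<close> is the square of the factor by which \<open>A\<close> stretches \<open>u\<close>, and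
  eigenvectors for different eigenvalues are orthogonal, before and after applying \<open>A\<close>.
\<close>

lemma eigenvectors_gram:
  fixes A :: "complex mat"
  assumes A: "A \<in> carrier_mat n n" and u: "u \<in> carrier_vec n" and v: "v \<in> carrier_vec n"
    and eu: "mat_adjoint A *\<^sub>v (A *\<^sub>v u) = a \<cdot>\<^sub>v u" and ev: "mat_adjoint A *\<^sub>v (A *\<^sub>v v) = b \<cdot>\<^sub>v v"
    and u0: "A *\<^sub>v u \<noteq> 0\<^sub>v n" and v0: "A *\<^sub>v v \<noteq> 0\<^sub>v n"
  shows "unit (A *\<^sub>v u) \<bullet>c unit (A *\<^sub>v v) = unit u \<bullet>c unit v"
proof -
  have stretch: "vec_norm w > 0 \<and> vec_norm (A *\<^sub>v w) > 0 \<and>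
      c = complex_of_real ((vec_norm (A *\<^sub>v w) / vec_norm w)\<^sup>2)"
    if w: "w \<in> carrier_vec n" and ew: "mat_adjoint A *\<^sub>v (A *\<^sub>v w) = c \<cdot>\<^sub>v w" and w0: "A *\<^sub>v w \<noteq> 0\<^sub>v n"
    for w c
  proof -
    have Aw: "A *\<^sub>v w \<in> carrier_vec n" by (rule mult_mat_vec_carrier[OF A w])
    have "w \<noteq> 0\<^sub>v n"
    proof
      assume "w = 0\<^sub>v n"
      then have "A *\<^sub>v w = 0\<^sub>v n" using A by (intro eq_vecI) auto
      with w0 show False by simp
    qed
    then have pos: "vec_norm w > 0" "vec_norm (A *\<^sub>v w) > 0"
      using vec_norm_pos w Aw w0 by auto
    have "(A *\<^sub>v w) \<bullet>c (A *\<^sub>v w) = c * (w \<bullet>c w)"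
      unfolding adjoint_cscalar_prod'[OF A Aw w] ew by (rule cscalar_prod_smult_left[OF w w])
    then have "c = complex_of_real ((vec_norm (A *\<^sub>v w))\<^sup>2) / complex_of_real ((vec_norm w)\<^sup>2)"
      using pos unfolding cscalar_prod_self by (simp add: field_simps)
    then show ?thesis using pos by (simp add: power_divide)
  qed
  note su = stretch[OF u eu u0] and sv = stretch[OF v ev v0]
  define r where "r = vec_norm (A *\<^sub>v u) / vec_norm u"
  define s where "s = vec_norm (A *\<^sub>v v) / vec_norm v"
  have r: "r > 0" "vec_norm (A *\<^sub>v u) = r * vec_norm u" "a = complex_of_real (r\<^sup>2)"
    using su by (auto simp: r_def)
  have s: "s > 0" "vec_norm (A *\<^sub>v v) = s * vec_norm v" "b = complex_of_real (s\<^sup>2)"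
    using sv by (auto simp: s_def)
  have Au: "A *\<^sub>v u \<in> carrier_vec n" and Av: "A *\<^sub>v v \<in> carrier_vec n"
    using A u v by (auto intro: mult_mat_vec_carrier)
  \<comment> \<open>Moving \<open>A\<close> across from either side evaluates the same inner product
    with the eigenvalue of \<open>u\<close> or with that of \<open>v\<close>. So either
    \<open>u \<bullet>c v\<close> is 0, or \<open>r = s\<close> and the stretch factors cancel
    against the norms.\<close>
  have 1: "(A *\<^sub>v u) \<bullet>c (A *\<^sub>v v) = r\<^sup>2 * (u \<bullet>c v)"
    unfolding adjoint_cscalar_prod'[OF A Au v] eu r(3) by (rule cscalar_prod_smult_left[OF u v])
  have 2: "(A *\<^sub>v u) \<bullet>c (A *\<^sub>v v) = s\<^sup>2 * (u \<bullet>c v)"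
    unfolding adjoint_cscalar_prod[OF A Av u] ev s(3)
    using cscalar_prod_smult_right[OF u v, of "complex_of_real (s\<^sup>2)"] by simp
  show ?thesis
  proof (cases "u \<bullet>c v = 0")
    case True
    then show ?thesis
      using 1 by (simp add: unit_cscalar_prod[OF Au Av] unit_cscalar_prod[OF u v])
  next
    case False
    then have "complex_of_real (r\<^sup>2) = complex_of_real (s\<^sup>2)" using 1 2 by simp
    then have "r\<^sup>2 = s\<^sup>2" by (simp only: of_real_eq_iff)
    then have "r = s" using r(1) s(1) by (simp add: power2_eq_iff_nonneg)
    then show ?thesis
      using r(1) su sv
      by (simp add: unit_cscalar_prod[OF Au Av] unit_cscalar_prod[OF u v] 1 r(2) s(2) power2_eq_square)
  qed
qed

lemma state_norm_tensor:
  assumes "\<And>j. j < length ds \<Longrightarrow> v j \<in> carrier_vec (ds ! j)"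
  shows "state_norm ds (tensor ds v) = (\<Prod>j<length ds. vec_norm (v j))"
proof -
  have "inner_prod ds (tensor ds v) (tensor ds v) = complex_of_real ((\<Prod>j<length ds. vec_norm (v j))\<^sup>2)"
    using assms by (simp add: inner_prod_tensor cscalar_prod_self prod_power_distrib)
  then show ?thesis
    by (simp only: state_norm_def Re_complex_of_real) (simp add: prod_nonneg)
qed

lemma normalize_tensor:
  assumes "\<And>j. j < length ds \<Longrightarrow> v j \<in> carrier_vec (ds ! j)"
  shows "normalize_state ds (tensor ds v) = tensor ds (\<lambda>j. unit (v j))"
proof -
  have "tensor ds (\<lambda>j. unit (v j)) =
      (\<lambda>ix. (\<Prod>j<length ds. 1 / complex_of_real (vec_norm (v j))) * tensor ds v ix)"
    unfolding unit_def by (rule tensor_smult) (rule assms)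
  moreover have "state_norm ds (tensor ds v) = (\<Prod>j<length ds. vec_norm (v j))"
    by (rule state_norm_tensor) (rule assms)
  ultimately show ?thesis
    by (simp add: normalize_state_def fun_eq_iff prod_dividef)
qed

lemma state_norm_normalize:
  assumes "\<phi> \<in> tensor_space ds" "\<phi> \<noteq> zero_state"
  shows "state_norm ds (normalize_state ds \<phi>) = 1"
proof -
  have n: "state_norm ds \<phi> \<noteq> 0" using assms state_norm_eq_0 by blast
  note state_norm_nonneg[of ds \<phi>]
  moreover have "normalize_state ds \<phi> = (\<lambda>ix. complex_of_real (1 / state_norm ds \<phi>) * \<phi> ix)"
    by (simp add: normalize_state_def fun_eq_iff)
  ultimately show ?thesis
    using n by (simp only: state_norm_scale norm_of_real) simp
qed

lemma inner_prod_normalize: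
  "inner_prod ds (normalize_state ds \<phi>) (normalize_state ds \<psi>) =
     inner_prod ds \<phi> \<psi> / (state_norm ds \<phi> * state_norm ds \<psi>)"
  using inner_prod_scale[of ds "1 / state_norm ds \<phi>" \<phi> "1 / state_norm ds \<psi>" \<psi>]
  by (simp add: normalize_state_def)

subsection \<open>LPCC protocols on a product basis\<close>

text \<open>The factors of a basis vector are determined only up to scalars with product 1, so one
  choice \<open>F\<close> is fixed. They need not be unit vectors, whence the later use of
  \<open>unit\<close>.\<close>

locale product_basis =
  fixes ds :: "nat list" and S :: "state set" and F :: "state \<Rightarrow> nat \<Rightarrow> complex vec"
  assumes basis: "orthonormal_basis ds S"
    and F_carrier: "\<And>\<psi> j. \<psi> \<in> S \<Longrightarrow> j < length ds \<Longrightarrow> F \<psi> j \<in> carrier_vec (ds ! j)"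
    and tensor_F: "\<And>\<psi>. \<psi> \<in> S \<Longrightarrow> tensor ds (F \<psi>) = \<psi>"
begin

definition local_ops :: "(nat \<Rightarrow> complex mat) \<Rightarrow> bool" where
  "local_ops A \<longleftrightarrow> (\<forall>j<length ds. A j \<in> carrier_mat (ds ! j) (ds ! j))"

text \<open>In the induction over a protocol, \<open>A j\<close> is the product of the projectors
  that party \<open>j\<close> has applied along the outcomes so far.\<close>

definition img :: "(nat \<Rightarrow> complex mat) \<Rightarrow> state \<Rightarrow> state" where
  "img A \<psi> = tensor ds (\<lambda>j. A j *\<^sub>v F \<psi> j)"

definition orthogonal_img :: "(nat \<Rightarrow> complex mat) \<Rightarrow> bool" where
  "orthogonal_img A \<longleftrightarrow>
     (\<forall>\<phi>\<in>S. \<forall>\<psi>\<in>S. \<phi> \<noteq> \<psi> \<longrightarrow> inner_prod ds (img A \<phi>) (img A \<psi>) = 0)"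

definition remaining :: "(nat \<Rightarrow> complex mat) \<Rightarrow> state set" where
  "remaining A = {normalize_state ds (img A \<psi>) | \<psi>. \<psi> \<in> S \<and> img A \<psi> \<noteq> zero_state}"

lemma finite_S: "finite S"
  and inner_S: "\<phi> \<in> S \<Longrightarrow> \<psi> \<in> S \<Longrightarrow> inner_prod ds \<phi> \<psi> = (if \<phi> = \<psi> then 1 else 0)"
  using basis by (auto simp: orthonormal_basis_def)

lemma state_norm_S: "\<psi> \<in> S \<Longrightarrow> state_norm ds \<psi> = 1"
  using inner_S[of \<psi> \<psi>] by (simp add: state_norm_def)

text \<open>This is where completeness of the basis enters: a vector is known once its inner
  products with \<open>S\<close> are known.\<close>

lemma expansion:
  assumes "\<omega> \<in> tensor_space ds"
  shows "\<omega> = (\<lambda>ix. \<Sum>\<psi>\<in>S. inner_prod ds \<psi> \<omega> * \<psi> ix)"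
proof -
  obtain c where c: "\<omega> = (\<lambda>ix. \<Sum>\<psi>\<in>S. c \<psi> * \<psi> ix)"
    using basis assms unfolding orthonormal_basis_def by blast
  have "inner_prod ds \<phi> \<omega> = c \<phi>" if "\<phi> \<in> S" for \<phi>
  proof -
    have "inner_prod ds \<phi> \<omega> = (\<Sum>\<psi>\<in>S. c \<psi> * inner_prod ds \<phi> \<psi>)"
      unfolding c inner_prod_def sum_distrib_left
      by (subst sum.swap) (simp add: ac_simps)
    also have "\<dots> = (\<Sum>\<psi>\<in>S. if \<phi> = \<psi> then c \<psi> else 0)"
      using that by (intro sum.cong) (auto simp: inner_S)
    finally show ?thesis using that finite_S by simp
  qed
  then show ?thesis by (subst c) (simp cong: sum.cong)
qed

lemma img_carrier:
  "local_ops A \<Longrightarrow> \<psi> \<in> S \<Longrightarrow> j < length ds \<Longrightarrow> A j *\<^sub>v F \<psi> j \<in> carrier_vec (ds ! j)"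
  using F_carrier by (auto simp: local_ops_def intro: mult_mat_vec_carrier)

lemma img_eigenvector:
  assumes A: "local_ops A" and orth: "orthogonal_img A"
    and \<phi>: "\<phi> \<in> S" and nz: "img A \<phi> \<noteq> zero_state" and j: "j < length ds"
  obtains c where "mat_adjoint (A j) *\<^sub>v (A j *\<^sub>v F \<phi> j) = c \<cdot>\<^sub>v F \<phi> j"
proof -
  \<comment> \<open>The factors of A^* A applied to \<open>\<phi>\<close>.\<close>
  define G where "G j = mat_adjoint (A j) *\<^sub>v (A j *\<^sub>v F \<phi> j)" for j
  have Aj: "A j \<in> carrier_mat (ds ! j) (ds ! j)" if "j < length ds" for j
    using A that by (simp add: local_ops_def)
  have G: "G j \<in> carrier_vec (ds ! j)" if "j < length ds" for j
    unfolding G_def using mat_adjoint_carrier[OF Aj[OF that]] img_carrier[OF A \<phi> that]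
    by (rule mult_mat_vec_carrier)
  have inner: "inner_prod ds \<psi> (tensor ds G) = inner_prod ds (img A \<psi>) (img A \<phi>)" if \<psi>: "\<psi> \<in> S" for \<psi>
  proof -
    have "inner_prod ds \<psi> (tensor ds G) = inner_prod ds (tensor ds (F \<psi>)) (tensor ds G)"
      by (simp add: tensor_F \<psi>)
    also have "\<dots> = (\<Prod>j<length ds. G j \<bullet>c F \<psi> j)"
      by (rule inner_prod_tensor) (use F_carrier[OF \<psi>] G in auto)
    also have "\<dots> = (\<Prod>j<length ds. (A j *\<^sub>v F \<phi> j) \<bullet>c (A j *\<^sub>v F \<psi> j))"
      unfolding G_def
      using adjoint_cscalar_prod'[OF Aj img_carrier[OF A \<phi>] F_carrier[OF \<psi>]]
      by (intro prod.cong) auto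
    also have "\<dots> = inner_prod ds (img A \<psi>) (img A \<phi>)"
      unfolding img_def
      by (rule inner_prod_tensor[symmetric]) (use img_carrier[OF A] \<psi> \<phi> in auto)
    finally show ?thesis .
  qed
  \<comment> \<open>The eigenvalue belonging to \<open>\<phi>\<close>. If it were 0,
    \<open>tensor ds G\<close> could vanish because of some other factor and would then say nothing
    about factor \<open>j\<close>.\<close>
  define c where "c = inner_prod ds (img A \<phi>) (img A \<phi>)"
  have "state_norm ds (img A \<phi>) \<noteq> 0"
    using state_norm_eq_0[of "img A \<phi>" ds] nz by (auto simp: img_def tensor_in_tensor_space)
  then have c0: "c \<noteq> 0" unfolding c_def inner_prod_self by simp
  have "tensor ds G ix = c * tensor ds (F \<phi>) ix" for ix
  proof -
    have "tensor ds G ix = (\<Sum>\<psi>\<in>S. inner_prod ds \<psi> (tensor ds G) * \<psi> ix)"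
      using fun_cong[OF expansion[OF tensor_in_tensor_space[of ds G]], of ix] .
    also have "\<dots> = (\<Sum>\<psi>\<in>S. if \<psi> = \<phi> then c * \<phi> ix else 0)"
      using orth \<phi> by (intro sum.cong) (auto simp: inner orthogonal_img_def c_def)
    also have "\<dots> = c * tensor ds (F \<phi>) ix"
      using finite_S \<phi> by (simp add: tensor_F)
    finally show ?thesis .
  qed
  then have eq: "tensor ds G = (\<lambda>ix. c * tensor ds (F \<phi>) ix)" by (rule ext)
  have "tensor ds (F \<phi>) \<noteq> zero_state"
    using state_norm_S[OF \<phi>] by (auto simp: tensor_F \<phi>)
  then obtain l where "G j = l \<cdot>\<^sub>v F \<phi> j"
    using tensor_proportional[of ds "F \<phi>" G c j] F_carrier[OF \<phi>] G eq c0 j by blast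
  then show ?thesis using that by (simp add: G_def)
qed

lemma remaining_distinguishable:
  assumes dist: "locally_distinguishable ds S" and A: "local_ops A" and orth: "orthogonal_img A"
  shows "locally_distinguishable ds (remaining A)"
proof -
  obtain p :: "state locc" where p: "valid_locc p ds" and pS: "\<And>\<psi>. \<psi> \<in> S \<Longrightarrow> guess_prob p ds \<psi> \<psi> = 1"
    using dist unfolding locally_distinguishable_def by auto
  define I where "I = {\<psi> \<in> S. img A \<psi> \<noteq> zero_state}"
  have IS: "\<psi> \<in> S" and I0: "img A \<psi> \<noteq> zero_state" if "\<psi> \<in> I" for \<psi>
    using that by (auto simp: I_def)
  have finI: "finite I" using finite_S by (simp add: I_def)
  have img_space: "img A \<psi> \<in> tensor_space ds" for \<psi>
    by (simp add: img_def tensor_in_tensor_space)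
  \<comment> \<open>Guesses of \<open>p\<close> range over all states, so the relabelling must be
    total. What lies outside \<open>I\<close> goes to \<open>zero_state\<close>, whose norm 0 keeps
    it apart from every remaining state.\<close>
  define f where "f \<psi> = (if \<psi> \<in> I then normalize_state ds (img A \<psi>) else zero_state)" for \<psi>
  have f_norm: "state_norm ds (f \<psi>) = 1" if "\<psi> \<in> I" for \<psi>
    using state_norm_normalize[OF img_space I0[OF that]] that by (simp add: f_def)
  have f_inj: "f t = f \<psi> \<longleftrightarrow> t = \<psi>" if \<psi>: "\<psi> \<in> I" for t \<psi>
  proof
    assume eq: "f t = f \<psi>"
    then have t: "t \<in> I" using f_norm[OF \<psi>] by (auto simp: f_def split: if_splits)
    show "t = \<psi>"
    proof (rule ccontr)
      assume "t \<noteq> \<psi>"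
      \<comment> \<open>Orthogonality makes the relabelling injective on \<open>I\<close>: a unit
        vector is not orthogonal to itself.\<close>
      then have "inner_prod ds (f t) (f \<psi>) = 0"
        using orth t \<psi> IS by (simp add: f_def inner_prod_normalize orthogonal_img_def)
      then show False using eq f_norm[OF \<psi>] inner_prod_self[of ds "f \<psi>"] by simp
    qed
  qed simp
  have gram: "unit (A j *\<^sub>v F \<phi> j) \<bullet>c unit (A j *\<^sub>v F \<psi> j) = unit (F \<phi> j) \<bullet>c unit (F \<psi> j)"
    if \<phi>: "\<phi> \<in> I" and \<psi>: "\<psi> \<in> I" and j: "j < length ds" for \<phi> \<psi> j
  proof -
    have nz: "A j *\<^sub>v F \<psi> j \<noteq> 0\<^sub>v (ds ! j)" if "\<psi> \<in> I" for \<psi>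
      using I0[OF that] tensor_eq_zero_state[OF j, of "\<lambda>j. A j *\<^sub>v F \<psi> j"] by (auto simp: img_def)
    have Aj: "A j \<in> carrier_mat (ds ! j) (ds ! j)" using A j by (simp add: local_ops_def)
    obtain a where a: "mat_adjoint (A j) *\<^sub>v (A j *\<^sub>v F \<phi> j) = a \<cdot>\<^sub>v F \<phi> j"
      using img_eigenvector[OF A orth IS[OF \<phi>] I0[OF \<phi>] j] .
    obtain b where b: "mat_adjoint (A j) *\<^sub>v (A j *\<^sub>v F \<psi> j) = b \<cdot>\<^sub>v F \<psi> j"
      using img_eigenvector[OF A orth IS[OF \<psi>] I0[OF \<psi>] j] .
    show ?thesis
      by (rule eigenvectors_gram[OF Aj F_carrier[OF IS[OF \<phi>] j] F_carrier[OF IS[OF \<psi>] j] a b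
            nz[OF \<phi>] nz[OF \<psi>]])
  qed
  obtain q where q: "valid_locc q ds" and qp: "\<And>\<psi> t. \<psi> \<in> I \<Longrightarrow>
      guess_prob q ds t (tensor ds (\<lambda>j. unit (A j *\<^sub>v F \<psi> j))) =
      guess_prob (map_locc f p) ds t (tensor ds (\<lambda>j. unit (F \<psi> j)))"
  proof (rule undo_protocol[of I ds "\<lambda>\<psi> j. unit (A j *\<^sub>v F \<psi> j)" "\<lambda>\<psi> j. unit (F \<psi> j)" "map_locc f p"])
    show "valid_locc (map_locc f p) ds" using p by (simp add: valid_locc_map_locc)
  qed (use finI gram img_carrier[OF A] F_carrier IS in auto)
  have "guess_prob q ds (f \<psi>) (f \<psi>) = 1" if \<psi>: "\<psi> \<in> I" for \<psi>
  proof -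
    have 1: "f \<psi> = tensor ds (\<lambda>j. unit (A j *\<^sub>v F \<psi> j))"
      using normalize_tensor[of ds "\<lambda>j. A j *\<^sub>v F \<psi> j"] img_carrier[OF A IS[OF \<psi>]] \<psi>
      by (simp add: f_def img_def)
    \<comment> \<open>Normalizing the factors one by one leaves \<open>\<psi>\<close> unchanged
      because the product of their norms is 1.\<close>
    have 2: "\<psi> = tensor ds (\<lambda>j. unit (F \<psi> j))"
      using normalize_tensor[of ds "F \<psi>"] F_carrier[OF IS[OF \<psi>]] state_norm_S[OF IS[OF \<psi>]]
      by (simp add: tensor_F IS[OF \<psi>] normalize_state_def)
    have "guess_prob q ds (f \<psi>) (f \<psi>) = guess_prob (map_locc f p) ds (f \<psi>) \<psi>"
      using qp[OF \<psi>, of "f \<psi>"] 1 2 by metis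
    also have "\<dots> = guess_prob p ds \<psi> \<psi>"
      by (rule guess_prob_map_locc) (rule f_inj[OF \<psi>])
    finally show ?thesis using pS IS[OF \<psi>] by simp
  qed
  moreover have "remaining A = f ` I"
    by (auto simp: remaining_def I_def f_def)
  ultimately show ?thesis
    using q unfolding locally_distinguishable_def by (intro exI[of _ q]) simp
qed

section \<open>Following a protocol through its accumulated operators\<close>

lemma local_op_img:
  assumes A: "local_ops A" and j: "j < length ds" and P: "P \<in> carrier_mat (ds ! j) (ds ! j)"
    and \<psi>: "\<psi> \<in> S"
  shows "local_op ds j P (img A \<psi>) = img (A(j := P * A j)) \<psi>"
proof -
  have Aj: "A j \<in> carrier_mat (ds ! j) (ds ! j)" using A j by (simp add: local_ops_def)
  have "local_op ds j P (img A \<psi>) =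
      tensor ds ((\<lambda>j. A j *\<^sub>v F \<psi> j)(j := P *\<^sub>v (A j *\<^sub>v F \<psi> j)))"
    unfolding img_def
    by (rule local_op_tensor[where v = "\<lambda>j. A j *\<^sub>v F \<psi> j", OF j P])
      (rule img_carrier[OF A \<psi> j])
  also have "\<dots> = img (A(j := P * A j)) \<psi>"
    unfolding img_def
    by (rule tensor_cong) (metis assoc_mult_mat_vec[OF P Aj F_carrier[OF \<psi> j]] fun_upd_apply)
  finally show ?thesis .
qed

lemma local_op_normalize:
  "local_op ds j P (normalize_state ds \<phi>) =
     (\<lambda>ix. complex_of_real (1 / state_norm ds \<phi>) * local_op ds j P \<phi> ix)"
proof -
  have "normalize_state ds \<phi> = (\<lambda>ix. complex_of_real (1 / state_norm ds \<phi>) * \<phi> ix)"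
    by (simp add: normalize_state_def fun_eq_iff)
  then show ?thesis by (simp only: local_op_scale)
qed

lemma img_norm_pos:
  assumes "img A \<psi> \<noteq> zero_state"
  shows "state_norm ds (img A \<psi>) > 0"
proof -
  have "state_norm ds (img A \<psi>) \<noteq> 0"
    using assms state_norm_eq_0[of "img A \<psi>" ds] by (auto simp: img_def tensor_in_tensor_space)
  then show ?thesis using state_norm_nonneg[of ds "img A \<psi>"] by linarith
qed

text \<open>Reduces a measurement outcome to an update of \<open>A\<close>. The normalization
  already present in \<open>remaining A\<close> is a positive scalar, which the next normalization
  absorbs.\<close>

lemma post_states_remaining:
  assumes A: "local_ops A" and j: "j < length ds" and P: "P \<in> carrier_mat (ds ! j) (ds ! j)"
  shows "post_states ds j P (remaining A) = remaining (A(j := P * A j))"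
proof -
  let ?B = "A(j := P * A j)"
  have step: "normalize_state ds (local_op ds j P (normalize_state ds (img A \<psi>))) =
        normalize_state ds (img ?B \<psi>) \<and>
      (local_op ds j P (normalize_state ds (img A \<psi>)) = zero_state \<longleftrightarrow> img ?B \<psi> = zero_state)"
    if \<psi>: "\<psi> \<in> S" and nz: "img A \<psi> \<noteq> zero_state" for \<psi>
  proof -
    have "1 / state_norm ds (img A \<psi>) > 0" using img_norm_pos[OF nz] by simp
    then show ?thesis
      unfolding local_op_normalize local_op_img[OF A j P \<psi>]
      by (simp only: normalize_state_scale) (auto simp: zero_state_def fun_eq_iff)
  qed
  \<comment> \<open>A state eliminated earlier stays eliminated, so no element of
    \<open>remaining ?B\<close> is missed.\<close>
  have nz: "img A \<psi> \<noteq> zero_state" if "\<psi> \<in> S" "img ?B \<psi> \<noteq> zero_state" for \<psi>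
    using that local_op_img[OF A j P, of \<psi>] by auto
  show ?thesis
  proof (intro equalityI subsetI)
    fix \<phi> assume "\<phi> \<in> post_states ds j P (remaining A)"
    then show "\<phi> \<in> remaining ?B"
      using step unfolding post_states_def remaining_def by blast
  next
    fix \<phi> assume "\<phi> \<in> remaining ?B"
    then obtain \<psi> where "\<psi> \<in> S" "img ?B \<psi> \<noteq> zero_state" "\<phi> = normalize_state ds (img ?B \<psi>)"
      by (auto simp: remaining_def)
    with step[of \<psi>] nz[of \<psi>] show "\<phi> \<in> post_states ds j P (remaining A)"
      unfolding post_states_def remaining_def by (simp del: fun_upd_apply) metis
  qed
qed

text \<open>The hypothesis on the measurement concerns distinct remaining states, the conclusion
  distinct elements of \<open>S\<close>. The orthogonality obtained so far bridges the gap, because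
  distinct surviving elements of \<open>S\<close> then have distinct normalized images; an
  eliminated one has image zero and is orthogonal to everything.\<close>

lemma orthogonal_img_step:
  assumes A: "local_ops A" and orth: "orthogonal_img A" and j: "j < length ds"
    and P: "P k \<in> carrier_mat (ds ! j) (ds ! j)" and k: "k < m"
    and pres: "orthogonality_preserving ds j m P (remaining A)"
  shows "orthogonal_img (A(j := P k * A j))"
  unfolding orthogonal_img_def
proof (intro ballI impI)
  let ?B = "A(j := P k * A j)"
  fix \<phi> \<psi> assume \<phi>: "\<phi> \<in> S" and \<psi>: "\<psi> \<in> S" and ne: "\<phi> \<noteq> \<psi>"
  show "inner_prod ds (img ?B \<phi>) (img ?B \<psi>) = 0"
  proof (cases "img A \<phi> = zero_state \<or> img A \<psi> = zero_state")
    case True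
    then have "img ?B \<phi> = zero_state \<or> img ?B \<psi> = zero_state"
      using local_op_img[OF A j P \<phi>] local_op_img[OF A j P \<psi>] by auto
    then show ?thesis by (auto simp: inner_prod_def zero_state_def)
  next
    case False
    let ?f = "normalize_state ds (img A \<phi>)" and ?g = "normalize_state ds (img A \<psi>)"
    let ?a = "1 / state_norm ds (img A \<phi>)" and ?b = "1 / state_norm ds (img A \<psi>)"
    have "inner_prod ds ?f ?g = 0"
      using orth \<phi> \<psi> ne by (simp add: inner_prod_normalize orthogonal_img_def)
    moreover have "inner_prod ds ?f ?f = 1"
      using state_norm_normalize[of "img A \<phi>" ds] False
      by (simp add: inner_prod_self img_def tensor_in_tensor_space)
    ultimately have "?f \<noteq> ?g" by auto
    moreover have "?f \<in> remaining A" "?g \<in> remaining A"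
      using \<phi> \<psi> False by (auto simp: remaining_def)
    ultimately have "inner_prod ds (local_op ds j (P k) ?f) (local_op ds j (P k) ?g) = 0"
      using pres k by (simp add: orthogonality_preserving_def)
    then have "complex_of_real ?a * complex_of_real ?b * inner_prod ds (img ?B \<phi>) (img ?B \<psi>) = 0"
      unfolding local_op_normalize local_op_img[OF A j P \<phi>] local_op_img[OF A j P \<psi>]
        inner_prod_scale by simp
    then show ?thesis
      using img_norm_pos[of A \<phi>] img_norm_pos[of A \<psi>] False by simp
  qed
qed

text \<open>The induction generalizes over \<open>A\<close> and keeps \<open>S\<close> fixed; local
  distinguishability is derived only at \<open>Stop\<close>, directly from that of \<open>S\<close>,
  and never passed from one intermediate set to the next.\<close>

lemma final_sets_distinguishable:
  assumes "locally_distinguishable ds S"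
    and "local_ops A" and "orthogonal_img A"
    and "orthogonality_preserving_lpcc p ds (remaining A)"
    and "T \<in> final_sets p ds (remaining A)"
  shows "locally_distinguishable ds T"
  using assms(2-)
proof (induction p arbitrary: A)
  case Stop
  then show ?case using remaining_distinguishable[OF assms(1)] by simp
next
  case (Measure j m P cont)
  from Measure.prems(3) have j: "j < length ds"
    and proj: "projective_measurement (ds ! j) m P"
    and pres: "orthogonality_preserving ds j m P (remaining A)"
    and rest: "\<And>k. k < m \<Longrightarrow>
      orthogonality_preserving_lpcc (cont k) ds (post_states ds j (P k) (remaining A))"
    by auto
  obtain k where k: "k < m"
    and T: "T \<in> final_sets (cont k) ds (post_states ds j (P k) (remaining A))"
    using Measure.prems(4) by auto
  have P: "P k \<in> carrier_mat (ds ! j) (ds ! j)"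
    using proj k by (simp add: projective_measurement_def)
  let ?B = "A(j := P k * A j)"
  note post = post_states_remaining[OF Measure.prems(1) j P]
  have "A j \<in> carrier_mat (ds ! j) (ds ! j)" using Measure.prems(1) j by (simp add: local_ops_def)
  then have "P k * A j \<in> carrier_mat (ds ! j) (ds ! j)" using P by (rule mult_carrier_mat[rotated])
  then have "local_ops ?B" using Measure.prems(1) by (simp add: local_ops_def)
  moreover have "orthogonal_img ?B"
    by (rule orthogonal_img_step[OF Measure.prems(1,2) j P k pres])
  ultimately show ?case
    using Measure.IH[of "cont k" ?B, OF rangeI] rest[OF k] T unfolding post by metis
qed

text \<open>Start of the induction: before any measurement the accumulated operators are
  identities.\<close>

lemma remaining_one:
  defines "A \<equiv> \<lambda>j. 1\<^sub>m (ds ! j)"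
  shows "local_ops A" "orthogonal_img A" "remaining A = S"
proof -
  have img: "img A \<psi> = \<psi>" if "\<psi> \<in> S" for \<psi>
  proof -
    have "img A \<psi> = tensor ds (F \<psi>)"
      unfolding img_def A_def by (rule tensor_cong) (simp add: F_carrier[OF that])
    then show ?thesis by (simp add: tensor_F that)
  qed
  show "local_ops A" by (simp add: local_ops_def A_def)
  show "orthogonal_img A" by (simp add: orthogonal_img_def img inner_S)
  have "normalize_state ds \<psi> = \<psi> \<and> \<psi> \<noteq> zero_state" if "\<psi> \<in> S" for \<psi>
    using state_norm_S[OF that] by (auto simp: normalize_state_def)
  then show "remaining A = S"
    unfolding remaining_def using img by force
qed

end

theorem theorem8:
  fixes n :: nat and ds :: "nat list" and S :: "(nat list \<Rightarrow> complex) set"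
  assumes "n \<ge> 2"
    and "length ds = n"
    and "complete_orthogonal_product_basis ds S"
    and "locally_distinguishable ds S"
  shows "\<not> activable_under_lpcc ds S"
proof -
  have "\<exists>v. (\<forall>j<length ds. v j \<in> carrier_vec (ds ! j)) \<and> tensor ds v = \<psi>" if "\<psi> \<in> S" for \<psi>
    using assms(3) that is_product_state_tensor[of ds \<psi>]
    unfolding complete_orthogonal_product_basis_def by metis
  then obtain F where "\<And>\<psi>. \<psi> \<in> S \<Longrightarrow>
      (\<forall>j<length ds. F \<psi> j \<in> carrier_vec (ds ! j)) \<and> tensor ds (F \<psi>) = \<psi>"
    by metis
  then interpret product_basis ds S F
    using assms(3) by unfold_locales (auto simp: complete_orthogonal_product_basis_def)
  show ?thesis
    using final_sets_distinguishable[OF assms(4) remaining_one(1,2)]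
    unfolding activable_under_lpcc_def remaining_one(3) by blast
qed

end
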